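(* Let $M$ be a canal surface in $\mathbb{R}^3$ with center curve $\alpha(s)$ and radius $r(s)$. If $M$ is either a cylinder or a cone, then $M$ is a non-degenerate flat canal surface.
   Context: A canal surface is the envelope of a 1-parameter family of spheres in $\mathbb{R}^3$. The curve $\alpha : I\to\mathbb{R}^3$ of centers ($I$ an interval) is the center curve, assumed parametrized by arc length $s$, and $r:I\to(0,\infty)$, the radius, is the smooth function such that $r(s)$ is the radius of the sphere centered at $\alpha(s)$. Let $T,N,B$ be the Frenet frame of $\alpha$ (when $\alpha$ is a straight line, $T,N,B$ is a constant orthonormal frame with $T=\alpha'$). The canal surface is parametrized by $$C(s,t)=\alpha(s)-R(s)T-Q(s)\cos(t)\,N+Q(s)\sin(t)\,B,$$ where $R(s)=r(s)r'(s)$ and $Q(s)=\pm r(s)\sqrt{1-r'(s)^2}$. $E=\langle C_s,C_s\rangle$, $F=\langle C_s,C_t\rangle$, $G=\langle C_t,C_t\rangle$ are the coefficients of the first fundamental form, and $e=\langle C_{ss},n\rangle$, $f=\langle C_{st},n\rangle$, $g=\langle C_{tt},n\rangle$ those of the second, with $n$ the unit normal. The surface is degenerate if its first fundamental form is degenerate ($EG-F^2=0$), and non-degenerate otherwise. The Gaussian curvature is $K=\frac{eg-f^2}{EG-F^2}$; the surface is flat if $K$ vanishes identically. A cylinder here is the canal surface with straight-line center curve and constant radius $r(s)=c\ne 0$; a cone is the canal surface with straight-line center curve and radius $r(s)=c_1s+c_2$ with constants $c_1,c_2$, $0<|c_1|<1$. *)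

theory Defs
  imports "HOL-Analysis.Analysis"
begin

text \<open>The interval \<open>I\<close> need not be open, so derivatives with respect to \<open>s\<close> are taken within \<open>I\<close>
  (one-sided at an endpoint belonging to \<open>I\<close>).\<close>

definition deriv_on :: "real set \<Rightarrow> (real \<Rightarrow> 'a::real_normed_vector) \<Rightarrow> real \<Rightarrow> 'a" where
  "deriv_on I f s = vector_derivative f (at s within I)"

definition smooth_on :: "real set \<Rightarrow> (real \<Rightarrow> 'a::real_normed_vector) \<Rightarrow> bool" where
  "smooth_on I f \<longleftrightarrow> (\<forall>k. ((deriv_on I ^^ k) f) differentiable_on I)"

definition proper_interval :: "real set \<Rightarrow> bool" where
  "proper_interval I \<longleftrightarrow> is_interval I \<and> interior I \<noteq> {}"

definition arc_length_curve :: "real set \<Rightarrow> (real \<Rightarrow> real^3) \<Rightarrow> bool" where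
  "arc_length_curve I \<alpha> \<longleftrightarrow> smooth_on I \<alpha> \<and> (\<forall>s\<in>I. norm (deriv_on I \<alpha> s) = 1)"

definition straight_line :: "real set \<Rightarrow> (real \<Rightarrow> real^3) \<Rightarrow> bool" where
  "straight_line I \<alpha> \<longleftrightarrow> (\<exists>p v. \<forall>s\<in>I. \<alpha> s = p + s *\<^sub>R v)"

text \<open>For a straight line the frame is any constant orthonormal frame containing the direction
  of the line; neither orientation is singled out.\<close>

definition frenet_frame ::
  "real set \<Rightarrow> (real \<Rightarrow> real^3) \<Rightarrow> (real \<Rightarrow> real^3) \<Rightarrow> (real \<Rightarrow> real^3) \<Rightarrow> (real \<Rightarrow> real^3) \<Rightarrow> bool" where
  "frenet_frame I \<alpha> T N B \<longleftrightarrow>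
     (\<forall>s\<in>I. T s = deriv_on I \<alpha> s) \<and>
     ((\<forall>s\<in>I. deriv_on I T s \<noteq> 0 \<and>
             N s = deriv_on I T s /\<^sub>R norm (deriv_on I T s) \<and>
             B s = cross3 (T s) (N s)) \<or>
      straight_line I \<alpha> \<and>
      (\<exists>T\<^sub>0 N\<^sub>0 B\<^sub>0. norm T\<^sub>0 = 1 \<and> norm N\<^sub>0 = 1 \<and> norm B\<^sub>0 = 1 \<and>
         T\<^sub>0 \<bullet> N\<^sub>0 = 0 \<and> T\<^sub>0 \<bullet> B\<^sub>0 = 0 \<and> N\<^sub>0 \<bullet> B\<^sub>0 = 0 \<and>
         (\<forall>s\<in>I. T s = T\<^sub>0 \<and> N s = N\<^sub>0 \<and> B s = B\<^sub>0)))"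

definition canal_R :: "real set \<Rightarrow> (real \<Rightarrow> real) \<Rightarrow> real \<Rightarrow> real" where
  "canal_R I r s = r s * deriv_on I r s"

text \<open>The factor \<open>\<sigma>\<close>, which is \<open>1\<close> or \<open>-1\<close>, is the sign in \<open>Q\<close>.\<close>

definition canal_Q :: "real \<Rightarrow> real set \<Rightarrow> (real \<Rightarrow> real) \<Rightarrow> real \<Rightarrow> real" where
  "canal_Q \<sigma> I r s = \<sigma> * (r s * sqrt (1 - (deriv_on I r s)\<^sup>2))"

definition canal_param ::
  "real set \<Rightarrow> (real \<Rightarrow> real^3) \<Rightarrow> (real \<Rightarrow> real) \<Rightarrow>
   (real \<Rightarrow> real^3) \<Rightarrow> (real \<Rightarrow> real^3) \<Rightarrow> (real \<Rightarrow> real^3) \<Rightarrow> real \<Rightarrow> real \<Rightarrow> real \<Rightarrow> real^3" where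
  "canal_param I \<alpha> r T N B \<sigma> s t =
     \<alpha> s - canal_R I r s *\<^sub>R T s
       - (canal_Q \<sigma> I r s * cos t) *\<^sub>R N s
       + (canal_Q \<sigma> I r s * sin t) *\<^sub>R B s"

text \<open>The condition \<open>\<bar>r'\<bar> \<le> 1\<close> makes \<open>Q\<close> real-valued.\<close>

definition canal_surface ::
  "real set \<Rightarrow> (real \<Rightarrow> real^3) \<Rightarrow> (real \<Rightarrow> real) \<Rightarrow>
   (real \<Rightarrow> real^3) \<Rightarrow> (real \<Rightarrow> real^3) \<Rightarrow> (real \<Rightarrow> real^3) \<Rightarrow> real \<Rightarrow> bool" where
  "canal_surface I \<alpha> r T N B \<sigma> \<longleftrightarrow>
     proper_interval I \<and> arc_length_curve I \<alpha> \<and> frenet_frame I \<alpha> T N B \<and>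
     smooth_on I r \<and> (\<forall>s\<in>I. r s > 0 \<and> \<bar>deriv_on I r s\<bar> \<le> 1) \<and>
     \<sigma> \<in> {1, -1}"

definition canal_cylinder :: "real set \<Rightarrow> (real \<Rightarrow> real^3) \<Rightarrow> (real \<Rightarrow> real) \<Rightarrow> bool" where
  "canal_cylinder I \<alpha> r \<longleftrightarrow> straight_line I \<alpha> \<and> (\<exists>c. c \<noteq> 0 \<and> (\<forall>s\<in>I. r s = c))"

definition canal_cone :: "real set \<Rightarrow> (real \<Rightarrow> real^3) \<Rightarrow> (real \<Rightarrow> real) \<Rightarrow> bool" where
  "canal_cone I \<alpha> r \<longleftrightarrow> straight_line I \<alpha> \<and>
     (\<exists>c\<^sub>1 c\<^sub>2. 0 < \<bar>c\<^sub>1\<bar> \<and> \<bar>c\<^sub>1\<bar> < 1 \<and> (\<forall>s\<in>I. r s = c\<^sub>1 * s + c\<^sub>2))"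

text \<open>Fundamental forms of a parametrized surface \<open>X\<close> with parameter domain \<open>I \<times> \<real>\<close>.\<close>

type_synonym surface = "real \<Rightarrow> real \<Rightarrow> real^3"

definition X_s :: "real set \<Rightarrow> surface \<Rightarrow> surface" where
  "X_s I X s t = deriv_on I (\<lambda>s. X s t) s"

definition X_t :: "surface \<Rightarrow> surface" where
  "X_t X s t = deriv_on UNIV (\<lambda>t. X s t) t"

definition unit_normal :: "real set \<Rightarrow> surface \<Rightarrow> surface" where
  "unit_normal I X s t =
     (let w = cross3 (X_s I X s t) (X_t X s t) in w /\<^sub>R norm w)"

definition fform_E :: "real set \<Rightarrow> surface \<Rightarrow> real \<Rightarrow> real \<Rightarrow> real" where
  "fform_E I X s t = X_s I X s t \<bullet> X_s I X s t"

definition fform_F :: "real set \<Rightarrow> surface \<Rightarrow> real \<Rightarrow> real \<Rightarrow> real" where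
  "fform_F I X s t = X_s I X s t \<bullet> X_t X s t"

definition fform_G :: "surface \<Rightarrow> real \<Rightarrow> real \<Rightarrow> real" where
  "fform_G X s t = X_t X s t \<bullet> X_t X s t"

definition sform_e :: "real set \<Rightarrow> surface \<Rightarrow> real \<Rightarrow> real \<Rightarrow> real" where
  "sform_e I X s t = X_s I (X_s I X) s t \<bullet> unit_normal I X s t"

definition sform_f :: "real set \<Rightarrow> surface \<Rightarrow> real \<Rightarrow> real \<Rightarrow> real" where
  "sform_f I X s t = X_t (X_s I X) s t \<bullet> unit_normal I X s t"

definition sform_g :: "real set \<Rightarrow> surface \<Rightarrow> real \<Rightarrow> real \<Rightarrow> real" where
  "sform_g I X s t = X_t (X_t X) s t \<bullet> unit_normal I X s t"

definition fform_det :: "real set \<Rightarrow> surface \<Rightarrow> real \<Rightarrow> real \<Rightarrow> real" where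
  "fform_det I X s t = fform_E I X s t * fform_G X s t - (fform_F I X s t)\<^sup>2"

definition gauss_curvature :: "real set \<Rightarrow> surface \<Rightarrow> real \<Rightarrow> real \<Rightarrow> real" where
  "gauss_curvature I X s t =
     (sform_e I X s t * sform_g I X s t - (sform_f I X s t)\<^sup>2) / fform_det I X s t"

text \<open>Non-degeneracy is required at every point, so that the Gaussian curvature is
  defined on the whole surface and flatness does not rest on division by zero.\<close>

definition nondegenerate :: "real set \<Rightarrow> surface \<Rightarrow> bool" where
  "nondegenerate I X \<longleftrightarrow> (\<forall>s\<in>I. \<forall>t. fform_det I X s t \<noteq> 0)"

definition flat :: "real set \<Rightarrow> surface \<Rightarrow> bool" where
  "flat I X \<longleftrightarrow> (\<forall>s\<in>I. \<forall>t. gauss_curvature I X s t = 0)"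

end

theory Submission imports Defs begin

text \<open>Along a straight center line with affine radius \<open>r s = c\<^sub>1 * s + c\<^sub>2\<close> the frame is constant and
  the surface is ruled: \<open>C s t = P + s *\<^sub>R T - (c\<^sub>1 * r s) *\<^sub>R T + r s *\<^sub>R w t\<close>, where \<open>w\<close> runs through
  a circle of radius \<open>q = sqrt (1 - c\<^sub>1\<^sup>2)\<close> in the plane spanned by \<open>N\<close> and \<open>B\<close>. The cylinder is the
  case \<open>c\<^sub>1 = 0\<close>. Then \<open>E = q\<^sup>2\<close>, \<open>F = 0\<close> and \<open>G = (r s)\<^sup>2 * q\<^sup>2\<close>, so the surface is
  non-degenerate. Moreover \<open>C\<^sub>s\<^sub>s = 0\<close>, and \<open>C\<^sub>s\<^sub>t\<close> is a multiple of \<open>C\<^sub>t\<close>, so \<open>e = f = 0\<close>.\<close>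

lemma proper_interval_UNIV: "proper_interval UNIV"
  by (simp add: proper_interval_def)

text \<open>A connected set with more than one point has no isolated point. This makes derivatives
  within \<open>I\<close> unique, also at an endpoint.\<close>

lemma proper_interval_at_within_neq_bot:
  assumes "proper_interval I" "s \<in> I"
  shows "at s within I \<noteq> bot"
proof -
  have "connected I" "I \<noteq> {s}"
    using assms by (auto simp: proper_interval_def is_interval_connected)
  with assms(2) have "s islimpt I"
    using connected_imp_perfect by blast
  then show ?thesis
    by (simp add: trivial_limit_within)
qed

text \<open>Reduces every derivative below to that of a closed formula \<open>g\<close>, which needs
  to agree with \<open>f\<close> only on \<open>I\<close>.\<close>

lemma deriv_on_eqI:
  assumes "proper_interval I" "s \<in> I"
    and "(g has_vector_derivative D) (at s within I)"
    and "\<And>x. x \<in> I \<Longrightarrow> f x = g x"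
  shows "deriv_on I f s = D"
proof -
  have "(f has_vector_derivative D) (at s within I)"
    by (rule has_vector_derivative_transform[OF assms(2) _ assms(3)]) (use assms(4) in auto)
  then show ?thesis
    unfolding deriv_on_def
    by (rule vector_derivative_within[OF proper_interval_at_within_neq_bot[OF assms(1,2)]])
qed

lemma inner_unit_normal_X_t_eq_0: "X_t X s t \<bullet> unit_normal I X s t = 0"
  by (simp add: unit_normal_def Let_def dot_cross_self)

text \<open>The tangent of a line is constant, so its derivative vanishes, which excludes the curved
  alternative in \<open>frenet_frame\<close>.\<close>

lemma straight_line_frenet_frame_const:
  assumes "proper_interval I" "straight_line I \<alpha>" "frenet_frame I \<alpha> T N B"
  obtains p T\<^sub>0 N\<^sub>0 B\<^sub>0 where
    "\<forall>s\<in>I. \<alpha> s = p + s *\<^sub>R T\<^sub>0 \<and> T s = T\<^sub>0 \<and> N s = N\<^sub>0 \<and> B s = B\<^sub>0"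
    "norm T\<^sub>0 = 1" "norm N\<^sub>0 = 1" "norm B\<^sub>0 = 1"
    "T\<^sub>0 \<bullet> N\<^sub>0 = 0" "T\<^sub>0 \<bullet> B\<^sub>0 = 0" "N\<^sub>0 \<bullet> B\<^sub>0 = 0"
proof -
  obtain p v where pv: "\<And>s. s \<in> I \<Longrightarrow> \<alpha> s = p + s *\<^sub>R v"
    using assms(2) by (auto simp: straight_line_def)
  have "deriv_on I \<alpha> s = v" if "s \<in> I" for s
    by (rule deriv_on_eqI[OF assms(1) that _ pv]) (auto intro!: derivative_eq_intros)
  then have T: "T s = v" if "s \<in> I" for s
    using assms(3) that by (simp add: frenet_frame_def)
  have T': "deriv_on I T s = 0" if "s \<in> I" for s
    by (rule deriv_on_eqI[OF assms(1) that _ T]) auto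
  \<comment> \<open>On an empty \<open>I\<close> the curved alternative would hold vacuously; a
    point of \<open>I\<close> refutes it.\<close>
  obtain a where a: "a \<in> I"
    using assms(1) interior_subset by (fastforce simp: proper_interval_def)
  from T' a assms(3) obtain T\<^sub>0 N\<^sub>0 B\<^sub>0 where
    fr: "norm T\<^sub>0 = 1" "norm N\<^sub>0 = 1" "norm B\<^sub>0 = 1"
    "T\<^sub>0 \<bullet> N\<^sub>0 = 0" "T\<^sub>0 \<bullet> B\<^sub>0 = 0" "N\<^sub>0 \<bullet> B\<^sub>0 = 0"
    "\<forall>s\<in>I. T s = T\<^sub>0 \<and> N s = N\<^sub>0 \<and> B s = B\<^sub>0"
    unfolding frenet_frame_def by blast
  with T a have "v = T\<^sub>0" by metis
  with pv fr show thesis by (intro that[of p T\<^sub>0 N\<^sub>0 B\<^sub>0]) auto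
qed

lemma straight_canal_surface_affine_radius:
  assumes canal: "canal_surface I \<alpha> r T N B \<sigma>"
    and line: "straight_line I \<alpha>"
    and r: "\<And>s. s \<in> I \<Longrightarrow> r s = c\<^sub>1 * s + c\<^sub>2" and c1: "\<bar>c\<^sub>1\<bar> < 1"
  defines "X \<equiv> canal_param I \<alpha> r T N B \<sigma>"
  shows "nondegenerate I X \<and> flat I X"
proof -
  have I: "proper_interval I" and frame: "frenet_frame I \<alpha> T N B"
    and rpos: "\<And>s. s \<in> I \<Longrightarrow> r s > 0" and \<sigma>: "\<sigma>\<^sup>2 = 1"
    using canal by (auto simp: canal_surface_def)
  obtain p T\<^sub>0 N\<^sub>0 B\<^sub>0 where
    frame_eq: "\<forall>s\<in>I. \<alpha> s = p + s *\<^sub>R T\<^sub>0 \<and> T s = T\<^sub>0 \<and> N s = N\<^sub>0 \<and> B s = B\<^sub>0"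
    and unit: "norm T\<^sub>0 = 1" "norm N\<^sub>0 = 1" "norm B\<^sub>0 = 1"
    and orth: "T\<^sub>0 \<bullet> N\<^sub>0 = 0" "T\<^sub>0 \<bullet> B\<^sub>0 = 0" "N\<^sub>0 \<bullet> B\<^sub>0 = 0"
    using straight_line_frenet_frame_const[OF I line frame] by blast
  note onb = orth orth[unfolded inner_commute[of T\<^sub>0] inner_commute[of N\<^sub>0 B\<^sub>0]]
    unit[unfolded norm_eq_1]
  define q where "q = sqrt (1 - c\<^sub>1\<^sup>2)"
  have q2: "q\<^sup>2 = 1 - c\<^sub>1\<^sup>2" "q\<^sup>2 > 0"
    using c1 by (auto simp: q_def abs_square_less_1 abs_square_le_1 less_imp_le)
  \<comment> \<open>The sign \<sigma> is absorbed into \<open>w\<close> and drops out of lengths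
    because its square is 1. The derivative \<open>w'\<close> is \<open>w\<close> advanced by a
    quarter turn, hence orthogonal to \<open>w\<close> and of equal length.\<close>
  define w where "w t = (\<sigma> * q) *\<^sub>R (sin t *\<^sub>R B\<^sub>0 - cos t *\<^sub>R N\<^sub>0)" for t
  define w' where "w' t = (\<sigma> * q) *\<^sub>R (cos t *\<^sub>R B\<^sub>0 + sin t *\<^sub>R N\<^sub>0)" for t
  have w_deriv: "(w has_vector_derivative w' t) (at t)" for t
    unfolding w_def w'_def
    by (auto intro!: derivative_eq_intros simp: algebra_simps)
  have "w t \<bullet> w t = (\<sigma> * q)\<^sup>2 * (sin t)\<^sup>2 + (\<sigma> * q)\<^sup>2 * (cos t)\<^sup>2"
    "w' t \<bullet> w' t = (\<sigma> * q)\<^sup>2 * (cos t)\<^sup>2 + (\<sigma> * q)\<^sup>2 * (sin t)\<^sup>2" for t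
    by (simp_all add: w_def w'_def inner_simps onb power2_eq_square algebra_simps)
  then have ww: "w t \<bullet> w t = q\<^sup>2" "w' t \<bullet> w' t = q\<^sup>2" for t
    using \<sigma> by (simp_all add: power_mult_distrib flip: distrib_left)
  have orth_w: "w t \<bullet> w' t = 0" "T\<^sub>0 \<bullet> w t = 0" "w t \<bullet> T\<^sub>0 = 0" "T\<^sub>0 \<bullet> w' t = 0" for t
    by (simp_all add: w_def w'_def inner_simps onb)

  have r': "deriv_on I r s = c\<^sub>1" if "s \<in> I" for s
    by (rule deriv_on_eqI[OF I that _ r])
      (auto intro!: derivative_eq_intros simp flip: has_real_derivative_iff_has_vector_derivative)
  have X: "X s t = p + s *\<^sub>R T\<^sub>0 - (c\<^sub>1 * (c\<^sub>1 * s + c\<^sub>2)) *\<^sub>R T\<^sub>0 + (c\<^sub>1 * s + c\<^sub>2) *\<^sub>R w t"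
    if "s \<in> I" for s t
    using that
    by (simp add: X_def canal_param_def canal_R_def canal_Q_def frame_eq r' r w_def
        flip: q_def) (simp add: algebra_simps)
  \<comment> \<open>The coefficient of \<open>T\<^sub>0\<close> is
    \<open>1 - c\<^sub>1\<^sup>2\<close>, that is, \<open>q\<^sup>2\<close>.\<close>
  have Xs: "X_s I X s t = q\<^sup>2 *\<^sub>R T\<^sub>0 + c\<^sub>1 *\<^sub>R w t" if "s \<in> I" for s t
    unfolding X_s_def
    by (rule deriv_on_eqI[OF I that _ X])
      (auto intro!: derivative_eq_intros simp: q2 power2_eq_square[of c\<^sub>1] algebra_simps)
  have Xt: "X_t X s t = r s *\<^sub>R w' t" if "s \<in> I" for s t
    unfolding X_t_def
    by (rule deriv_on_eqI[OF proper_interval_UNIV _ _ X[OF that]])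
      (auto intro!: derivative_eq_intros w_deriv simp: r that)
  have Xss: "X_s I (X_s I X) s t = 0" if "s \<in> I" for s t
    unfolding X_s_def[of I "X_s I X"]
    by (rule deriv_on_eqI[OF I that _ Xs]) auto
  have "X_t (X_s I X) s t = c\<^sub>1 *\<^sub>R w' t" if "s \<in> I" for s t
    unfolding X_t_def
    by (rule deriv_on_eqI[OF proper_interval_UNIV _ _ Xs[OF that]])
      (auto intro!: derivative_eq_intros w_deriv)
  then have Xst: "X_t (X_s I X) s t = (c\<^sub>1 / r s) *\<^sub>R X_t X s t" if "s \<in> I" for s t
    using that rpos[OF that] by (simp add: Xt)

  have EFG: "fform_E I X s t = q\<^sup>2" "fform_F I X s t = 0" "fform_G X s t = (r s)\<^sup>2 * q\<^sup>2"
    if "s \<in> I" for s t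
  proof -
    have "fform_E I X s t = q\<^sup>2 * (q\<^sup>2 + c\<^sub>1\<^sup>2)"
      using that
      by (simp add: fform_E_def Xs inner_simps ww orth_w onb power2_eq_square algebra_simps)
    then show "fform_E I X s t = q\<^sup>2" by (simp add: q2)
  qed (simp_all add: that fform_F_def fform_G_def Xs Xt inner_simps ww orth_w power2_eq_square)
  \<comment> \<open>The determinant is \<open>(r s)\<^sup>2 * q^4\<close>, positive since
    \<open>r s > 0\<close> and \<open>\<bar>c\<^sub>1\<bar> < 1\<close>.\<close>
  have "fform_det I X s t \<noteq> 0" if "s \<in> I" for s t
    using that q2(2) rpos[OF that] by (simp add: fform_det_def EFG)
  \<comment> \<open>With \<open>e = f = 0\<close> the numerator of the curvature vanishes whatever
    \<open>g\<close> is.\<close>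
  moreover have "sform_e I X s t = 0" "sform_f I X s t = 0" if "s \<in> I" for s t
    using that by (simp_all add: sform_e_def sform_f_def Xss Xst inner_unit_normal_X_t_eq_0)
  ultimately show ?thesis
    by (simp add: nondegenerate_def flat_def gauss_curvature_def)
qed

theorem theorem4:
  fixes I :: "real set" and \<alpha> T N B :: "real \<Rightarrow> real^3" and r :: "real \<Rightarrow> real" and \<sigma> :: real
  assumes "canal_surface I \<alpha> r T N B \<sigma>"
    and "canal_cylinder I \<alpha> r \<or> canal_cone I \<alpha> r"
  shows "nondegenerate I (canal_param I \<alpha> r T N B \<sigma>) \<and> flat I (canal_param I \<alpha> r T N B \<sigma>)"
proof -
  have "straight_line I \<alpha> \<and> (\<exists>c\<^sub>1 c\<^sub>2. \<bar>c\<^sub>1\<bar> < 1 \<and> (\<forall>s\<in>I. r s = c\<^sub>1 * s + c\<^sub>2))"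
    using assms(2)
  proof
    assume "canal_cylinder I \<alpha> r"
    then obtain c where "straight_line I \<alpha>" "\<forall>s\<in>I. r s = 0 * s + c"
      by (auto simp: canal_cylinder_def)
    then show ?thesis by (metis abs_zero zero_less_one)
  qed (auto simp: canal_cone_def)
  then show ?thesis
    using straight_canal_surface_affine_radius[OF assms(1)] by blast
qed

end
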